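(* For each integer $r\ge 2$, there exists an integer $C\ge 1$ such that the following holds: let $q$ and $n$ be integers such that $q > r$ and $n\ge Cq$. If $M$ is a matching of $K_n^r$, then $K_n^r-M$ has a fractional $K_q^r$-decomposition.
   Context: $K_n^r$ is the complete $r$-uniform hypergraph on $n$ vertices. A matching of $K_n^r$ is a set of pairwise vertex-disjoint edges; $K_n^r-M$ is obtained by deleting the edges of $M$ (keeping all vertices). A fractional $K_q^r$-decomposition of an $r$-uniform hypergraph $G$ is an assignment of non-negative real weights to the copies of $K_q^r$ in $G$ such that for every edge $f$ of $G$, the total weight of copies containing $f$ is exactly $1$. *)

theory Defs
  imports Complex_Main
begin

datatype 'a hypergraph = Hypergraph (verts: "'a set") (edges: "'a set set")

definition complete_hypergraph_on :: "'a set \<Rightarrow> nat \<Rightarrow> 'a hypergraph" where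
  "complete_hypergraph_on V r = Hypergraph V {e. e \<subseteq> V \<and> finite e \<and> card e = r}"

definition complete_hypergraph :: "nat \<Rightarrow> nat \<Rightarrow> nat hypergraph" where
  "complete_hypergraph n r = complete_hypergraph_on {..<n} r"

definition matching :: "'a hypergraph \<Rightarrow> 'a set set \<Rightarrow> bool" where
  "matching G M \<longleftrightarrow> M \<subseteq> edges G \<and> pairwise disjnt M"

definition delete_edges :: "'a hypergraph \<Rightarrow> 'a set set \<Rightarrow> 'a hypergraph" where
  "delete_edges G M = Hypergraph (verts G) (edges G - M)"

(* The type does not force edges to consist of vertices, so this is required of H here. *)
definition subhypergraph :: "'a hypergraph \<Rightarrow> 'a hypergraph \<Rightarrow> bool" where
  "subhypergraph H G \<longleftrightarrow>
     verts H \<subseteq> verts G \<and> edges H \<subseteq> edges G \<and> (\<forall>e\<in>edges H. e \<subseteq> verts H)"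

definition isomorphic :: "'a hypergraph \<Rightarrow> 'b hypergraph \<Rightarrow> bool" where
  "isomorphic H F \<longleftrightarrow> (\<exists>f. bij_betw f (verts H) (verts F) \<and> (\<lambda>e. f ` e) ` edges H = edges F)"

definition copies :: "'b hypergraph \<Rightarrow> 'a hypergraph \<Rightarrow> 'a hypergraph set" where
  "copies F G = {H. subhypergraph H G \<and> isomorphic H F}"

(* For use with finite G only: a sum over an infinite set of copies would be 0. *)
definition fractional_decomposition ::
    "'b hypergraph \<Rightarrow> 'a hypergraph \<Rightarrow> ('a hypergraph \<Rightarrow> real) \<Rightarrow> bool" where
  "fractional_decomposition F G w \<longleftrightarrow>
     (\<forall>H\<in>copies F G. 0 \<le> w H) \<and>
     (\<forall>f\<in>edges G. (\<Sum>H | H \<in> copies F G \<and> f \<in> edges H. w H) = 1)"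

definition has_fractional_decomposition :: "'b hypergraph \<Rightarrow> 'a hypergraph \<Rightarrow> bool" where
  "has_fractional_decomposition F G \<longleftrightarrow> (\<exists>w. fractional_decomposition F G w)"

lemma finite_copies:
  assumes "finite (verts G)" "finite (edges G)"
  shows "finite (copies F G)"
proof (rule finite_subset)
  show "copies F G \<subseteq> (\<lambda>(V, E). Hypergraph V E) ` (Pow (verts G) \<times> Pow (edges G))"
  proof
    fix H assume "H \<in> copies F G"
    then show "H \<in> (\<lambda>(V, E). Hypergraph V E) ` (Pow (verts G) \<times> Pow (edges G))"
      by (cases H) (auto simp: copies_def subhypergraph_def)
  qed
  show "finite ((\<lambda>(V, E). Hypergraph V E) ` (Pow (verts G) \<times> Pow (edges G)))"
    using assms by simp
qed

lemma copies_complete_hypergraph: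
  "copies (complete_hypergraph q r) G =
     {complete_hypergraph_on S r | S. S \<subseteq> verts G \<and> finite S \<and> card S = q \<and>
        edges (complete_hypergraph_on S r) \<subseteq> edges G}" (is "?L = ?R")
proof
  show "?L \<subseteq> ?R"
  proof
    fix H assume "H \<in> ?L"
    then obtain f where sub: "subhypergraph H G"
      and f: "bij_betw f (verts H) {..<q}"
      and img: "(\<lambda>e. f ` e) ` edges H = {e. e \<subseteq> {..<q} \<and> finite e \<and> card e = r}"
      by (auto simp: copies_def isomorphic_def complete_hypergraph_def complete_hypergraph_on_def)
    have fin: "finite (verts H)" and card: "card (verts H) = q"
      using bij_betw_finite[OF f] bij_betw_same_card[OF f] by simp_all
    have inj: "inj_on f (verts H)" and onto: "f ` verts H = {..<q}"
      using f by (auto simp: bij_betw_def)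
    have wf: "\<And>e. e \<in> edges H \<Longrightarrow> e \<subseteq> verts H"
      using sub by (auto simp: subhypergraph_def)
    have "edges H = {e. e \<subseteq> verts H \<and> finite e \<and> card e = r}"
    proof (intro set_eqI iffI)
      fix e assume e: "e \<in> edges H"
      then have "card (f ` e) = r" using img by blast
      moreover have "card (f ` e) = card e"
        using card_image[OF inj_on_subset[OF inj wf[OF e]]] by simp
      ultimately show "e \<in> {e. e \<subseteq> verts H \<and> finite e \<and> card e = r}"
        using wf[OF e] fin finite_subset by auto
    next
      fix e assume e: "e \<in> {e. e \<subseteq> verts H \<and> finite e \<and> card e = r}"
      then have "card (f ` e) = r"
        using card_image[OF inj_on_subset[OF inj]] by auto
      then have "f ` e \<in> (\<lambda>e. f ` e) ` edges H"
        unfolding img using e onto by blast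
      then obtain e' where e': "e' \<in> edges H" "f ` e = f ` e'" by auto
      then have "e = e'"
        using inj_on_image_eq_iff[OF inj] e wf by auto
      then show "e \<in> edges H" using e' by simp
    qed
    then have "H = complete_hypergraph_on (verts H) r"
      by (cases H) (simp add: complete_hypergraph_on_def)
    moreover from this have "edges (complete_hypergraph_on (verts H) r) \<subseteq> edges G"
      using sub by (simp add: subhypergraph_def)
    moreover have "verts H \<subseteq> verts G"
      using sub by (simp add: subhypergraph_def)
    ultimately show "H \<in> ?R"
      using fin card by blast
  qed
  show "?R \<subseteq> ?L"
  proof
    fix H assume "H \<in> ?R"
    then obtain S where H: "H = complete_hypergraph_on S r" and S: "S \<subseteq> verts G" "finite S"
      "card S = q" "edges H \<subseteq> edges G" by auto
    obtain f where f: "bij_betw f S {..<q}"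
      using S by (metis card_lessThan finite_lessThan finite_same_card_bij)
    then have inj: "inj_on f S" and onto: "f ` S = {..<q}" by (auto simp: bij_betw_def)
    have "(\<lambda>e. f ` e) ` {e. e \<subseteq> S \<and> finite e \<and> card e = r} =
        {e. e \<subseteq> {..<q} \<and> finite e \<and> card e = r}" (is "?A = ?B")
    proof
      show "?A \<subseteq> ?B"
        using onto card_image[OF inj_on_subset[OF inj]] by auto
      show "?B \<subseteq> ?A"
      proof
        fix e assume e: "e \<in> ?B"
        then obtain d where d: "d \<subseteq> S" "e = f ` d"
          using onto by (metis (lifting) mem_Collect_eq subset_imageE)
        then have "card d = r" "finite d"
          using e card_image[OF inj_on_subset[OF inj d(1)]] finite_subset[OF d(1) S(2)] by simp_all
        then show "e \<in> ?A" using d by auto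
      qed
    qed
    then have "isomorphic H (complete_hypergraph q r)"
      using f by (auto simp: H isomorphic_def complete_hypergraph_def complete_hypergraph_on_def)
    moreover have "subhypergraph H G"
      using S by (simp add: H subhypergraph_def complete_hypergraph_on_def)
    ultimately show "H \<in> ?L"
      by (simp add: copies_def)
  qed
qed

end

theory Submission
  imports Defs
begin

text \<open>It suffices to find a random vertex set \<open>x\<close> that has at least \<open>q\<close> elements, contains no edge
  of \<open>M\<close>, and contains every other \<open>r\<close>-set with the same positive probability: one then passes to
  a uniformly random \<open>q\<close>-subset of \<open>x\<close>. Since \<open>card V \<ge> r (r + 1) q\<close>, there are disjoint
  \<open>(r + 1)\<close>-sets \<open>U\<^sub>1, \<dots>, U\<^sub>q\<close> whose union meets every edge of \<open>M\<close> in at most one vertex. Let \<open>x\<close> be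
  uniformly random subject to the parity constraints that \<open>card (x \<inter> e)\<close> has the parity of \<open>r + 1\<close>
  for \<open>e \<in> M\<close>, and \<open>card (x \<inter> U\<^sub>j)\<close> is odd. The constraints forbid \<open>e \<subseteq> x\<close> and force \<open>x\<close> to meet
  every \<open>U\<^sub>j\<close>. A nonempty sum over \<open>GF(2)\<close> of constraint sets either has more than \<open>r\<close> elements or
  is an edge of \<open>M\<close>, so for an \<open>r\<close>-set \<open>f \<notin> M\<close> no character other than the trivial one
  contributes to the probability of \<open>f \<subseteq> x\<close>.\<close>

section \<open>Counting the sets between two given sets\<close>

lemma bij_betw_Un_Pow_Diff:
  assumes "A \<subseteq> B"
  shows "bij_betw (\<lambda>T. T \<union> A) (Pow (B - A)) {A..B}"
  by (rule bij_betw_byWitness[where f' = "\<lambda>S. S - A"]) (use assms in auto)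

lemma card_subset_interval:
  assumes "finite B" "A \<subseteq> B"
  shows "card {A..B} = 2 ^ (card B - card A)"
  using bij_betw_same_card[OF bij_betw_Un_Pow_Diff[OF assms(2)]] assms
  by (simp add: card_Pow card_Diff_subset finite_subset)

lemma card_subset_interval_with_card:
  assumes "finite B" "A \<subseteq> B" "card A \<le> q"
  shows "card {S \<in> {A..B}. card S = q} = (card B - card A) choose (q - card A)"
proof -
  have fin: "finite A" using assms finite_subset by blast
  have card_Un: "card (T \<union> A) = card T + card A" if "T \<subseteq> B - A" for T
    using that assms fin by (subst card_Un_disjoint) (auto dest: finite_subset)
  have "bij_betw (\<lambda>T. T \<union> A) {T. T \<subseteq> B - A \<and> card T = q - card A} {S \<in> {A..B}. card S = q}"
  proof (rule bij_betw_byWitness[where f' = "\<lambda>S. S - A"])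
    show "(\<lambda>T. T \<union> A) ` {T. T \<subseteq> B - A \<and> card T = q - card A} \<subseteq> {S \<in> {A..B}. card S = q}"
      using assms card_Un by auto
    show "(\<lambda>S. S - A) ` {S \<in> {A..B}. card S = q} \<subseteq> {T. T \<subseteq> B - A \<and> card T = q - card A}"
      using fin by (auto simp: card_Diff_subset)
  qed auto
  from bij_betw_same_card[OF this] show ?thesis
    using assms fin by (simp add: n_subsets card_Diff_subset)
qed

lemma finite_subset_interval: "finite B \<Longrightarrow> finite {A..B :: 'a set}"
  by (rule finite_subset[of _ "Pow B"]) auto

section \<open>Characters of the power set under parity constraints\<close>

text \<open>Toggling the membership of \<open>v\<close> maps \<open>{f..V}\<close> to itself, as
  \<open>v\<close> is in \<open>V\<close> but not in \<open>f\<close>. It changes the parity of an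
  odd number of the intersections \<open>x \<inter> c\<close>, so it reverses the sign of the
  product.\<close>

lemma sum_character_eq_0:
  fixes f V :: "'a set"
  assumes "finite V" "finite K" "v \<in> V - f" "odd (card {c \<in> K. v \<in> c})"
  shows "(\<Sum>x\<in>{f..V}. \<Prod>c\<in>K. (-1::real) ^ card (x \<inter> c)) = 0"
proof -
  define h where "h x = (\<Prod>c\<in>K. (-1::real) ^ card (x \<inter> c))" for x :: "'a set"
  define flip where "flip x = (if v \<in> x then x - {v} else insert v x)" for x
  have flip_sign: "(-1::real) ^ card (flip x \<inter> c) = (if v \<in> c then -1 else 1) * (-1) ^ card (x \<inter> c)"
    if "finite x" for x c
  proof (cases "v \<in> c")
    case True
    show ?thesis
    proof (cases "v \<in> x")
      case True
      then have "x \<inter> c = insert v (flip x \<inter> c)" "v \<notin> flip x \<inter> c" "finite (flip x \<inter> c)"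
        using \<open>v \<in> c\<close> that by (auto simp: flip_def)
      then show ?thesis using \<open>v \<in> c\<close> by simp
    next
      case False
      then have "flip x \<inter> c = insert v (x \<inter> c)" using \<open>v \<in> c\<close> by (auto simp: flip_def)
      then show ?thesis using \<open>v \<in> c\<close> False that by simp
    qed
  next
    case False
    then have "flip x \<inter> c = x \<inter> c" by (auto simp: flip_def)
    then show ?thesis using False by simp
  qed
  have h_flip: "h (flip x) = - h x" if "finite x" for x
  proof -
    have "(\<Prod>c\<in>K. if v \<in> c then -1 else 1::real) = (-1) ^ card {c \<in> K. v \<in> c}"
      using assms(2) by (simp add: prod.If_cases Int_def)
    then show ?thesis
      using assms(4) by (simp add: h_def flip_sign[OF that] prod.distrib)
  qed
  have "sum h {f..V} = (\<Sum>x\<in>{f..V}. h (flip x))"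
    by (rule sum.reindex_bij_witness[of _ flip flip])
       (use assms in \<open>auto simp: flip_def insert_absorb\<close>)
  also have "\<dots> = (\<Sum>x\<in>{f..V}. - h x)"
    by (rule sum.cong) (use assms finite_subset h_flip in auto)
  finally show ?thesis by (simp add: sum_negf h_def)
qed

text \<open>The weight below is, up to scaling, the indicator of the solution set of parity constraints,
  one for each \<open>c \<in> \<C>\<close>; expanding the product turns it into a sum of characters of
  the power set of \<open>V\<close>.\<close>

lemma sum_prod_characters:
  fixes f V :: "'a set" and s :: "'a set \<Rightarrow> real"
  assumes "finite V" "finite \<C>" "f \<subseteq> V"
    and odd: "\<And>K. K \<subseteq> \<C> \<Longrightarrow> K \<noteq> {} \<Longrightarrow> \<exists>v\<in>V - f. odd (card {c \<in> K. v \<in> c})"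
  shows "(\<Sum>x\<in>{f..V}. \<Prod>c\<in>\<C>. 1 + s c * (-1) ^ card (x \<inter> c)) = 2 ^ (card V - card f)"
proof -
  have "(\<Sum>x\<in>{f..V}. \<Prod>c\<in>\<C>. s c * (-1) ^ card (x \<inter> c) + 1)
      = (\<Sum>x\<in>{f..V}. \<Sum>K\<in>Pow \<C>. prod s K * (\<Prod>c\<in>K. (-1) ^ card (x \<inter> c)))"
    using assms(2) by (simp add: prod_add prod.distrib)
  also have "\<dots> = (\<Sum>K\<in>Pow \<C>. prod s K * (\<Sum>x\<in>{f..V}. \<Prod>c\<in>K. (-1) ^ card (x \<inter> c)))"
    by (subst sum.swap) (simp add: sum_distrib_left)
  also have "\<dots> = (\<Sum>K\<in>{{}}. prod s K * (\<Sum>x\<in>{f..V}. \<Prod>c\<in>K. (-1) ^ card (x \<inter> c)))"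
  proof (rule sum.mono_neutral_right)
    show "\<forall>K\<in>Pow \<C> - {{}}. prod s K * (\<Sum>x\<in>{f..V}. \<Prod>c\<in>K. (-1) ^ card (x \<inter> c)) = 0"
    proof
      fix K assume K: "K \<in> Pow \<C> - {{}}"
      then obtain v where v: "v \<in> V - f" "odd (card {c \<in> K. v \<in> c})" using odd[of K] by blast
      have "finite K" using K assms(2) finite_subset by blast
      then show "prod s K * (\<Sum>x\<in>{f..V}. \<Prod>c\<in>K. (-1) ^ card (x \<inter> c)) = 0"
        using sum_character_eq_0[OF assms(1) _ v] by simp
    qed
  qed (use assms in auto)
  also have "\<dots> = 2 ^ (card V - card f)"
    using assms by (simp add: card_subset_interval)
  finally show ?thesis by (simp add: add.commute)
qed

section \<open>From weights on larger cliques to weights on \<open>q\<close>-cliques\<close>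

text \<open>Each \<open>x\<close> spreads its weight evenly over its \<open>q\<close>-subsets,
  scaled so that every edge inside \<open>x\<close> receives exactly \<open>g x\<close> through
  them.\<close>

lemma has_fractional_decomposition_from_larger_cliques:
  fixes G :: "'a hypergraph" and g :: "'a set \<Rightarrow> real"
  assumes fin: "finite (verts G)" and "r \<le> q"
    and edges: "\<And>f. f \<in> edges G \<Longrightarrow> f \<subseteq> verts G \<and> card f = r"
    and nonneg: "\<And>x. x \<subseteq> verts G \<Longrightarrow> 0 \<le> g x"
    and large: "\<And>x. x \<subseteq> verts G \<Longrightarrow> g x \<noteq> 0 \<Longrightarrow> q \<le> card x"
    and clique: "\<And>x. x \<subseteq> verts G \<Longrightarrow> g x \<noteq> 0 \<Longrightarrow> edges (complete_hypergraph_on x r) \<subseteq> edges G"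
    and total: "\<And>f. f \<in> edges G \<Longrightarrow> (\<Sum>x\<in>{f..verts G}. g x) = 1"
  shows "has_fractional_decomposition (complete_hypergraph q r) G"
proof -
  \<comment> \<open>For \<open>q \<le> card x\<close>, the divisor counts the
    \<open>q\<close>-subsets of \<open>x\<close> that contain a fixed \<open>r\<close>-set.\<close>
  define u where "u x = g x / ((card x - r) choose (q - r))" for x
  define w where "w H = (\<Sum>x\<in>{verts H..verts G}. u x)" for H
  have "0 \<le> w H" for H
    unfolding w_def u_def by (intro sum_nonneg divide_nonneg_nonneg) (auto intro: nonneg)
  moreover have "(\<Sum>H | H \<in> copies (complete_hypergraph q r) G \<and> f \<in> edges H. w H) = 1"
    if f: "f \<in> edges G" for f
  proof -
    have f_sub: "f \<subseteq> verts G" and f_card: "card f = r" using edges[OF f] by auto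
    have f_fin: "finite f" using f_sub fin finite_subset by blast
    define \<S> where "\<S> = {S \<in> {f..verts G}. card S = q}"
    define \<S>' where "\<S>' = {S \<in> \<S>. edges (complete_hypergraph_on S r) \<subseteq> edges G}"
    have fin_\<S>: "finite \<S>"
      unfolding \<S>_def by (rule finite_subset[OF _ finite_subset_interval[OF fin]]) blast
    have "{H. H \<in> copies (complete_hypergraph q r) G \<and> f \<in> edges H}
        = (\<lambda>S. complete_hypergraph_on S r) ` \<S>'"
    proof -
      have "f \<in> edges (complete_hypergraph_on S r) \<longleftrightarrow> f \<subseteq> S" for S
        using f_card f_fin by (simp add: complete_hypergraph_on_def)
      then show ?thesis
        unfolding copies_complete_hypergraph \<S>_def \<S>'_def
        using finite_subset[OF _ fin] by (auto simp del: atLeastAtMost_iff simp: atLeastAtMost_def)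
    qed
    moreover have "inj_on (\<lambda>S. complete_hypergraph_on S r) \<S>'"
      by (auto simp: inj_on_def complete_hypergraph_on_def)
    ultimately have "(\<Sum>H | H \<in> copies (complete_hypergraph q r) G \<and> f \<in> edges H. w H)
        = (\<Sum>S\<in>\<S>'. \<Sum>x\<in>{S..verts G}. u x)"
      by (simp add: sum.reindex w_def complete_hypergraph_on_def)
    \<comment> \<open>If \<open>S\<close> does not span a clique of \<open>G\<close>, no
      \<open>x\<close> containing it does, so \<open>clique\<close> forces
      \<open>g x = 0\<close>.\<close>
    also have "\<dots> = (\<Sum>S\<in>\<S>. \<Sum>x\<in>{S..verts G}. u x)"
    proof (rule sum.mono_neutral_left[OF fin_\<S>])
      show "\<forall>S\<in>\<S> - \<S>'. (\<Sum>x\<in>{S..verts G}. u x) = 0"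
      proof (intro ballI sum.neutral)
        fix S x assume S: "S \<in> \<S> - \<S>'" and x: "x \<in> {S..verts G}"
        then have "edges (complete_hypergraph_on S r) \<subseteq> edges (complete_hypergraph_on x r)"
          by (auto simp: complete_hypergraph_on_def)
        then have "\<not> edges (complete_hypergraph_on x r) \<subseteq> edges G"
          using S by (auto simp: \<S>'_def)
        then show "u x = 0" using clique[of x] x by (auto simp: u_def)
      qed
    qed (auto simp: \<S>'_def)
    also have "\<dots> = (\<Sum>S\<in>\<S>. \<Sum>x | x \<in> {f..verts G} \<and> S \<subseteq> x. u x)"
      by (intro sum.cong refl) (fastforce simp: \<S>_def)
    also have "\<dots> = (\<Sum>x\<in>{f..verts G}. \<Sum>S | S \<in> \<S> \<and> S \<subseteq> x. u x)"
      by (rule sum.swap_restrict[OF fin_\<S> finite_subset_interval[OF fin]])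
    also have "\<dots> = (\<Sum>x\<in>{f..verts G}. g x)"
    proof (rule sum.cong[OF refl])
      fix x assume x: "x \<in> {f..verts G}"
      then have x_fin: "finite x" using fin finite_subset by auto
      have "{S. S \<in> \<S> \<and> S \<subseteq> x} = {S \<in> {f..x}. card S = q}"
        using x by (auto simp: \<S>_def)
      then have "(\<Sum>S | S \<in> \<S> \<and> S \<subseteq> x. u x) = ((card x - r) choose (q - r)) * u x"
        using card_subset_interval_with_card[of x f q] x x_fin f_card \<open>r \<le> q\<close> by simp
      \<comment> \<open>If \<open>g x \<noteq> 0\<close>, the binomial coefficient is positive by
        \<open>large\<close> and cancels.\<close>
      also have "\<dots> = g x"
        using large[of x] x by (cases "g x = 0") (auto simp: u_def)
      finally show "(\<Sum>S | S \<in> \<S> \<and> S \<subseteq> x. u x) = g x" .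
    qed
    finally show ?thesis using total[OF f] by simp
  qed
  ultimately show ?thesis
    unfolding has_fractional_decomposition_def fractional_decomposition_def by blast
qed

section \<open>Disjoint blocks and a partial transversal of the matching\<close>

lemma obtain_disjoint_subsets_with_card:
  assumes "finite W" "q * k \<le> card W" "k > 0"
  obtains \<U> where "card \<U> = q" "finite \<U>" "pairwise disjnt \<U>" "\<And>U. U \<in> \<U> \<Longrightarrow> U \<subseteq> W \<and> card U = k"
  using assms
proof (induction q arbitrary: W thesis)
  case 0
  from 0(1)[of "{}"] show ?case by auto
next
  case (Suc q)
  obtain U where U: "U \<subseteq> W" "card U = k" "finite U"
    using obtain_subset_with_card_n[of k W] Suc.prems by (auto simp: algebra_simps)
  have "q * k \<le> card (W - U)"
    using U Suc.prems by (simp add: card_Diff_subset algebra_simps)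
  then obtain \<U> where \<U>: "card \<U> = q" "finite \<U>" "pairwise disjnt \<U>"
    "\<And>U'. U' \<in> \<U> \<Longrightarrow> U' \<subseteq> W - U \<and> card U' = k"
    using Suc.IH[of "W - U"] Suc.prems by blast
  \<comment> \<open>Disjointness alone would allow \<open>U = {}\<close>; \<open>k > 0\<close>
    excludes it, so inserting \<open>U\<close> raises the cardinality.\<close>
  have "U \<notin> \<U>"
  proof
    assume "U \<in> \<U>"
    then have "U = {}" using \<U>(4) by blast
    then show False using U \<open>k > 0\<close> by simp
  qed
  moreover have "pairwise disjnt (insert U \<U>)"
    using \<U>(3,4) by (fastforce simp: pairwise_insert disjnt_def)
  ultimately show ?case
    using Suc.prems(1)[of "insert U \<U>"] \<U> U by auto
qed

text \<open>Delete all but one vertex of each edge. This removes \<open>(r - 1) * card M\<close>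
  vertices, and \<open>r * card M \<le> card V\<close> by disjointness.\<close>

lemma obtain_partial_transversal:
  fixes V :: "'a set"
  assumes "finite V" "pairwise disjnt M" "r \<ge> 1" "\<And>e. e \<in> M \<Longrightarrow> e \<subseteq> V \<and> card e = r"
  obtains W where "W \<subseteq> V" "card V \<le> r * card W"
    "\<And>e a b. e \<in> M \<Longrightarrow> a \<in> e \<inter> W \<Longrightarrow> b \<in> e \<inter> W \<Longrightarrow> a = b"
proof -
  have fin_M: "finite M" by (rule finite_subset[of _ "Pow V"]) (use assms in auto)
  have fin_e: "finite e" if "e \<in> M" for e using that assms finite_subset by blast
  have "e \<noteq> {}" if "e \<in> M" for e using assms(3) assms(4)[OF that] by auto
  then have "\<exists>p. p \<in> e" if "e \<in> M" for e using that by blast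
  then obtain p where p: "\<And>e. e \<in> M \<Longrightarrow> p e \<in> e" by metis
  define W where "W = V - (\<Union>e\<in>M. e - {p e})"
  have disj: "e \<inter> e' = {}" if "e \<in> M" "e' \<in> M" "e \<noteq> e'" for e e'
    using assms(2) that by (auto simp: pairwise_def disjnt_def)
  have "card (\<Union>M) = r * card M"
    using assms fin_e by (subst card_Union_disjoint) auto
  moreover have "card (\<Union>M) \<le> card V"
    using assms by (intro card_mono) auto
  ultimately have M_le: "r * card M \<le> card V" by simp
  have "card (\<Union>e\<in>M. e - {p e}) = (\<Sum>e\<in>M. card (e - {p e}))"
    using fin_M fin_e disj by (intro card_UN_disjoint) auto
  also have "\<dots> = card M * (r - 1)"
    using p assms(4) fin_e by simp
  finally have del: "card (\<Union>e\<in>M. e - {p e}) = card M * (r - 1)" .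
  have card_W: "card W = card V - card M * (r - 1)"
    unfolding W_def using assms fin_M fin_e by (subst card_Diff_subset) (auto simp: del)
  obtain r' where r': "r = Suc r'" using assms(3) by (cases r) auto
  have "card M * r' \<le> card V" using M_le by (simp add: r' algebra_simps)
  \<comment> \<open>The bound \<open>card V \<le> r * card W\<close> rearranges to
    \<open>M_le\<close> multiplied by \<open>r' = r - 1\<close>.\<close>
  moreover have "r' * card M * Suc r' \<le> r' * card V"
    using mult_left_mono[OF M_le, of r'] by (simp add: r' algebra_simps)
  ultimately have "card V \<le> r * card W"
    by (simp add: card_W r' diff_mult_distrib2 algebra_simps)
  moreover have "a = b" if "e \<in> M" "a \<in> e \<inter> W" "b \<in> e \<inter> W" for e a b
    using that by (auto simp: W_def)
  moreover have "W \<subseteq> V" by (auto simp: W_def)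
  ultimately show thesis using that by blast
qed

section \<open>Vertices of odd degree in a family of constraint sets\<close>

lemma odd_degree_in_Union:
  assumes "odd (card {c \<in> K. v \<in> c})"
  shows "v \<in> \<Union>K"
proof (rule ccontr)
  assume "v \<notin> \<Union>K"
  then have "{c \<in> K. v \<in> c} = {}" by blast
  then have "card {c \<in> K. v \<in> c} = 0" by (simp only: card.empty)
  then show False using assms by simp
qed

text \<open>The vertices of odd degree include one for each \<open>a \<in> U\<close>, namely \<open>a\<close> itself or, if \<open>a\<close> lies in an
  edge of \<open>K \<inter> M\<close>, another vertex of this edge.\<close>

lemma card_odd_degree_ge:
  assumes "pairwise disjnt M" "pairwise disjnt \<U>" "K \<subseteq> M \<union> \<U>" "U \<in> K" "U \<in> \<U>"
    and fin: "finite (\<Union>K)"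
    and sub: "\<And>U. U \<in> \<U> \<Longrightarrow> U \<subseteq> W"
    and M_card: "\<And>e. e \<in> M \<Longrightarrow> card e \<ge> 2"
    and transversal: "\<And>e a b. e \<in> M \<Longrightarrow> a \<in> e \<inter> W \<Longrightarrow> b \<in> e \<inter> W \<Longrightarrow> a = b"
  shows "card U \<le> card {v. odd (card {c \<in> K. v \<in> c})}"
proof -
  have in_M: "e = e'" if "e \<in> M" "e' \<in> M" "v \<in> e" "v \<in> e'" for e e' v
    using assms(1) that by (auto simp: pairwise_def disjnt_def)
  have in_\<U>: "c = c'" if "c \<in> \<U>" "c' \<in> \<U>" "v \<in> c" "v \<in> c'" for c c' v
    using assms(2) that by (auto simp: pairwise_def disjnt_def)
  define \<phi> where "\<phi> a = (if \<exists>e\<in>K \<inter> M. a \<in> e then SOME b. b \<noteq> a \<and> (\<exists>e\<in>K \<inter> M. a \<in> e \<and> b \<in> e) else a)" for a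
  have \<phi>: "\<phi> a \<noteq> a \<and> \<phi> a \<in> e" if "e \<in> K" "e \<in> M" "a \<in> e" for a e
  proof -
    have "\<exists>b. b \<in> e \<and> b \<noteq> a"
      using M_card[OF that(2)] that(3)
      by (metis One_nat_def Suc_1 card.infinite card_le_Suc0_iff_eq not_less_eq_eq zero_le)
    then have "\<exists>b. b \<noteq> a \<and> (\<exists>e\<in>K \<inter> M. a \<in> e \<and> b \<in> e)" using that by blast
    then have "\<phi> a \<noteq> a \<and> (\<exists>e\<in>K \<inter> M. a \<in> e \<and> \<phi> a \<in> e)"
      unfolding \<phi>_def by (smt (verit, best) someI_ex)
    \<comment> \<open>The choice refers to some edge of \<open>K \<inter> M\<close> through
      \<open>a\<close>; disjointness of \<open>M\<close> identifies it with
      \<open>e\<close>.\<close>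
    then show ?thesis using in_M that by blast
  qed
  have \<phi>_id: "\<phi> a = a" if "\<not> (\<exists>e\<in>K \<inter> M. a \<in> e)" for a
    unfolding \<phi>_def if_not_P[OF that] ..
  have \<phi>_notin_W: "\<phi> a \<notin> W" if "a \<in> U" "e \<in> K" "e \<in> M" "a \<in> e" for a e
    using \<phi>[OF that(2-4)] transversal[OF that(3), of a "\<phi> a"] that sub[OF \<open>U \<in> \<U>\<close>] by auto
  have odd: "odd (card {c \<in> K. \<phi> a \<in> c})" if a: "a \<in> U" for a
  proof (cases "\<exists>e\<in>K \<inter> M. a \<in> e")
    case True
    then obtain e where e: "e \<in> K" "e \<in> M" "a \<in> e" by auto
    have "\<phi> a \<notin> W" using \<phi>_notin_W[OF a] e by blast
    \<comment> \<open>Members of \<open>\<U>\<close> lie inside \<open>W\<close>, so only members of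
      \<open>M\<close> can contain \<open>\<phi> a\<close>.\<close>
    then have "{c \<in> K. \<phi> a \<in> c} = {e}"
      using \<open>K \<subseteq> M \<union> \<U>\<close> sub \<phi>[OF e] e in_M by blast
    then show ?thesis by simp
  next
    case False
    have "c = U" if "c \<in> K" "a \<in> c" for c
    proof -
      have "c \<in> \<U>" using that False \<open>K \<subseteq> M \<union> \<U>\<close> by blast
      then show ?thesis using in_\<U> \<open>U \<in> \<U>\<close> that(2) a by blast
    qed
    then have "{c \<in> K. \<phi> a \<in> c} = {U}"
      unfolding \<phi>_id[OF False] using \<open>U \<in> K\<close> a by blast
    then show ?thesis by simp
  qed
  \<comment> \<open>Membership of \<open>\<phi> a\<close> in \<open>W\<close> tells whether
    \<open>a\<close> was moved. Two moved points with the same image lie in one edge, which meets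
    \<open>W\<close> at most once.\<close>
  have "inj_on \<phi> U"
  proof (rule inj_onI)
    fix a b assume ab: "a \<in> U" "b \<in> U" "\<phi> a = \<phi> b"
    have W: "a \<in> W" "b \<in> W" using ab sub[OF \<open>U \<in> \<U>\<close>] by auto
    show "a = b"
    proof (cases "\<exists>e\<in>K \<inter> M. a \<in> e")
      case True
      then obtain e where e: "e \<in> K" "e \<in> M" "a \<in> e" by auto
      then have "\<phi> b \<notin> W" using \<phi>_notin_W[OF ab(1) e] ab(3) by simp
      then obtain e' where e': "e' \<in> K" "e' \<in> M" "b \<in> e'" using \<phi>_id[of b] W by force
      have "e = e'" using in_M[OF e(2) e'(2), of "\<phi> a"] \<phi>[OF e] \<phi>[OF e'] ab(3) by simp
      then show ?thesis using transversal[OF e(2), of a b] e e' W by simp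
    next
      case False
      then have "\<phi> a = a" by (rule \<phi>_id)
      then have "\<not> (\<exists>e\<in>K \<inter> M. b \<in> e)" using \<phi>_notin_W[OF ab(2)] ab(3) W by fastforce
      then show ?thesis using \<phi>_id[of b] \<open>\<phi> a = a\<close> ab(3) by simp
    qed
  qed
  moreover have "\<phi> ` U \<subseteq> {v. odd (card {c \<in> K. v \<in> c})}" using odd by auto
  moreover have "{v. odd (card {c \<in> K. v \<in> c})} \<subseteq> \<Union>K"
    using odd_degree_in_Union by auto
  ultimately show ?thesis
    using card_inj_on_le finite_subset[OF _ fin] by blast
qed

section \<open>The random set given by the parity constraints\<close>

lemma card_disjoint_family_le:
  assumes "finite x" "pairwise disjnt \<U>" "\<And>U. U \<in> \<U> \<Longrightarrow> x \<inter> U \<noteq> {}"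
  shows "card \<U> \<le> card x"
proof -
  have "\<exists>p. p \<in> x \<inter> U" if "U \<in> \<U>" for U using assms(3)[OF that] by blast
  then obtain p where p: "\<And>U. U \<in> \<U> \<Longrightarrow> p U \<in> x \<inter> U" by metis
  have "inj_on p \<U>"
    using p assms(2) unfolding inj_on_def pairwise_def disjnt_def by (metis IntD2 disjoint_iff)
  then show ?thesis using card_inj_on_le[of p \<U> x] p assms(1) by blast
qed

lemma complete_minus_matching_has_fractional_decomposition:
  fixes V :: "'a set"
  assumes fin: "finite V" and "r \<ge> 2" "q \<ge> r" and n: "r * (r + 1) * q \<le> card V"
    and "matching (complete_hypergraph_on V r) M"
  shows "has_fractional_decomposition (complete_hypergraph q r)
    (delete_edges (complete_hypergraph_on V r) M)"
proof -
  have M: "e \<subseteq> V \<and> card e = r" if "e \<in> M" for e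
    using assms(5) that by (auto simp: matching_def complete_hypergraph_on_def)
  have disj_M: "pairwise disjnt M" using assms(5) by (simp add: matching_def)
  obtain W where W: "W \<subseteq> V" "card V \<le> r * card W"
    and transversal: "\<And>e a b. e \<in> M \<Longrightarrow> a \<in> e \<inter> W \<Longrightarrow> b \<in> e \<inter> W \<Longrightarrow> a = b"
    using obtain_partial_transversal[OF fin disj_M, of r] M assms(2) by (metis One_nat_def Suc_1 Suc_leD)
  have "r * (q * (r + 1)) \<le> r * card W" using n W(2) by (simp add: algebra_simps)
  then have "q * (r + 1) \<le> card W" using \<open>r \<ge> 2\<close> by simp
  then obtain \<U> where \<U>: "card \<U> = q" "finite \<U>" "pairwise disjnt \<U>"
    "\<And>U. U \<in> \<U> \<Longrightarrow> U \<subseteq> W \<and> card U = r + 1"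
    using obtain_disjoint_subsets_with_card[of W q "r + 1"] finite_subset[OF W(1) fin] by auto
  have notM: "U \<notin> M" if "U \<in> \<U>" for U using \<U>(4)[OF that] M by auto
  have fin_M: "finite M" by (rule finite_subset[of _ "Pow V"]) (use fin M in auto)
  define \<C> where "\<C> = M \<union> \<U>"
  have fin_\<C>: "finite \<C>" using fin_M \<U> by (simp add: \<C>_def)
  have \<C>_sub: "c \<subseteq> V" if "c \<in> \<C>" for c using that M \<U>(4) W(1) unfolding \<C>_def by blast
  \<comment> \<open>Each factor \<open>1 + s c * (-1) ^ k\<close> is 0 or 2. It is 2 exactly when
    \<open>k\<close> has the parity of \<open>r + 1\<close> (for \<open>c \<in> M\<close>) or is odd
    (otherwise).\<close>
  define s :: "'a set \<Rightarrow> real" where "s c = (if c \<in> M then - ((-1) ^ r) else -1)" for c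
  \<comment> \<open>The divisor is the value of \<open>sum_prod_characters\<close> at an
    \<open>r\<close>-set.\<close>
  define g where "g x = (\<Prod>c\<in>\<C>. 1 + s c * (-1) ^ card (x \<inter> c)) / 2 ^ (card V - r)" for x
  have factor_nonneg: "0 \<le> 1 + s c * (-1) ^ k" for c k
    by (cases "even r"; cases "even k") (auto simp: s_def)
  let ?G = "delete_edges (complete_hypergraph_on V r) M"
  have verts: "verts ?G = V" and edges: "edges ?G = {e. e \<subseteq> V \<and> finite e \<and> card e = r} - M"
    by (auto simp: delete_edges_def complete_hypergraph_on_def)
  show ?thesis
  proof (rule has_fractional_decomposition_from_larger_cliques[where g = g], unfold verts edges)
    show "0 \<le> g x" for x
      unfolding g_def by (intro divide_nonneg_nonneg prod_nonneg) (auto simp: factor_nonneg)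
  next
    fix x assume x: "x \<subseteq> V" "g x \<noteq> 0"
    then have factor: "1 + s c * (-1) ^ card (x \<inter> c) \<noteq> 0" if "c \<in> \<C>" for c
      using that fin_\<C> by (auto simp: g_def)
    \<comment> \<open>An empty intersection is even, so the factor of \<open>U\<close> would
      vanish.\<close>
    have "x \<inter> U \<noteq> {}" if "U \<in> \<U>" for U
      using factor[of U] that notM by (auto simp: \<C>_def s_def)
    then show "q \<le> card x"
      using card_disjoint_family_le[of x \<U>] \<U> x fin finite_subset by blast
    have "\<not> e \<subseteq> x" if "e \<in> M" for e
    proof
      assume "e \<subseteq> x"
      then have "card (x \<inter> e) = r" using M[OF that] by (simp add: Int_absorb1)
      then show False
        using factor[of e] that by (simp add: \<C>_def s_def flip: power_mult_distrib)
    qed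
    then show "edges (complete_hypergraph_on x r) \<subseteq> {e. e \<subseteq> V \<and> finite e \<and> card e = r} - M"
      using x by (auto simp: complete_hypergraph_on_def)
  next
    fix f assume "f \<in> {e. e \<subseteq> V \<and> finite e \<and> card e = r} - M"
    then have f: "f \<subseteq> V" "finite f" "card f = r" "f \<notin> M" by auto
    have "\<exists>v\<in>V - f. odd (card {c \<in> K. v \<in> c})" if K: "K \<subseteq> \<C>" "K \<noteq> {}" for K
    proof -
      have deg_pos: "v \<in> V" if "odd (card {c \<in> K. v \<in> c})" for v
        using odd_degree_in_Union[OF that] K(1) \<C>_sub by blast
      show ?thesis
      proof (cases "K \<inter> \<U> = {}")
        case True
        then obtain e where e: "e \<in> K" "e \<in> M" using K by (auto simp: \<C>_def)
        \<comment> \<open>Here \<open>e\<close> and \<open>f\<close> are distinct sets of the same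
          size \<open>r\<close>.\<close>
        have "\<not> e \<subseteq> f" using card_subset_eq[OF f(2)] f M[OF e(2)] e by auto
        then obtain v where v: "v \<in> e" "v \<notin> f" by auto
        have "c = e" if "c \<in> K" "v \<in> c" for c
        proof -
          have "c \<in> M" using that True K(1) by (auto simp: \<C>_def)
          then show ?thesis using pairwiseD[OF disj_M _ e(2)] that(2) v(1) by (auto simp: disjnt_iff)
        qed
        then have "{c \<in> K. v \<in> c} = {e}" using e v by blast
        then show ?thesis using v M[OF e(2)] by (intro bexI[of _ v]) auto
      next
        case False
        then obtain U where U: "U \<in> K" "U \<in> \<U>" by auto
        have "card U \<le> card {v. odd (card {c \<in> K. v \<in> c})}"
        proof (rule card_odd_degree_ge[OF disj_M \<U>(3) _ U _ _ _ transversal])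
          show "finite (\<Union>K)" using K \<C>_sub by (intro finite_subset[OF _ fin]) blast
        qed (use K \<U>(4) M \<open>r \<ge> 2\<close> in \<open>auto simp: \<C>_def\<close>)
        \<comment> \<open>The blocks have \<open>r + 1\<close> elements precisely to exceed
          \<open>card f = r\<close>.\<close>
        then have "card f < card {v. odd (card {c \<in> K. v \<in> c})}"
          using f \<U>(4)[OF U(2)] by simp
        then have "\<not> {v. odd (card {c \<in> K. v \<in> c})} \<subseteq> f"
          using card_mono[OF f(2), of "{v. odd (card {c \<in> K. v \<in> c})}"] by linarith
        then show ?thesis using deg_pos by blast
      qed
    qed
    from sum_prod_characters[OF fin fin_\<C> f(1) this, of s]
    show "(\<Sum>x\<in>{f..V}. g x) = 1"
      by (simp add: g_def f(3) flip: sum_divide_distrib)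
  qed (use fin assms in auto)
qed

theorem theorem3p2:
  fixes r :: nat
  assumes "r \<ge> 2"
  shows "\<exists>C::nat. C \<ge> 1 \<and>
    (\<forall>(q::nat) (n::nat) (M :: nat set set).
       q > r \<longrightarrow> n \<ge> C * q \<longrightarrow> matching (complete_hypergraph n r) M \<longrightarrow>
       has_fractional_decomposition (complete_hypergraph q r)
         (delete_edges (complete_hypergraph n r) M))"
\<comment> \<open>The factor \<open>r\<close> pays for passing to the transversal \<open>W\<close>,
  and \<open>r + 1\<close> is the size of each of the \<open>q\<close> blocks cut from it.\<close>
proof (intro exI[of _ "r * (r + 1)"] conjI allI impI)
  fix q n :: nat and M :: "nat set set"
  assume "q > r" "r * (r + 1) * q \<le> n" "matching (complete_hypergraph n r) M"
  then show "has_fractional_decomposition (complete_hypergraph q r)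
      (delete_edges (complete_hypergraph n r) M)"
    unfolding complete_hypergraph_def[of n]
    using assms by (intro complete_minus_matching_has_fractional_decomposition) simp_all
qed (use assms in simp)

end
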